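(* For every ab-ba rotor type $r$, $m(UU(r))+m(DD(r))=2m(r)$.
   Context: A two-state rotor type is an infinite periodic sequence $r=(r^{(1)},r^{(2)},\dots)$ over $\{1,2\}$ with fundamental period $|r|$ (convention $r^{(1)}=1$). It is ab-ba if $|r|$ is even and for every $k\ge0$ the pair $(r^{(2k+1)},r^{(2k+2)})$ is $(1,2)$ or $(2,1)$. For such a sequence $s$ of even period, if exactly $k$ of the pairs $(s^{(2i+1)},s^{(2i+2)})$, $0\le i<|s|/2$, equal $(2,1)$, the ba-frequency is $m(s)=2k/|s|$ (labels are taken literally, not renormalized). Rotor-router dynamics: at each non-target vertex $v$ there is a periodic sequence $e_v^{(1)},e_v^{(2)},\dots$ of out-edges; a particle starts at the source, on its $j$-th visit to $v$ leaves along $e_v^{(j)}$, and whenever it reaches a target it is returned to the source; the hitting sequence is the (periodic) sequence of targets reached. The compressor for $r$ has non-target vertices $1$ (source), $2,3$ and targets $4,5$. On the $j$-th departure: from vertex $1$ the particle goes to vertex $2$ if $r^{(j)}=1$ and to vertex $3$ if $r^{(j)}=2$; from vertex $2$, in variant $U$ it goes to vertex $1$ if $r^{(j)}=1$ and to target $4$ if $r^{(j)}=2$, in variant $D$ to target $4$ if $r^{(j)}=1$ and to vertex $1$ if $r^{(j)}=2$; from vertex $3$ likewise with target $5$. $UU(r)$ (resp. $DD(r)$) is the hitting sequence with variant $U$ (resp. $D$) at both vertices $2$ and $3$, written with $4$ replaced by $1$ and $5$ by $2$; it is again ab-ba. *)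

theory Defs
  imports Complex_Main "HOL-Library.Infinite_Set"
begin

text \<open>A sequence \<open>(s\<^sub>1, s\<^sub>2, \<dots>)\<close> is a function on the
  naturals shifted by one: the term with index \<open>j \<ge> 1\<close> is \<open>s (j - 1)\<close>.\<close>

definition is_period :: "(nat \<Rightarrow> 'a) \<Rightarrow> nat \<Rightarrow> bool" where
  "is_period s p \<longleftrightarrow> 0 < p \<and> (\<forall>n. s (n + p) = s n)"

definition fund_period :: "(nat \<Rightarrow> 'a) \<Rightarrow> nat" where
  "fund_period s = (LEAST p. is_period s p)"

definition rotor_type :: "(nat \<Rightarrow> nat) \<Rightarrow> bool" where
  "rotor_type r \<longleftrightarrow> (\<exists>p. is_period r p) \<and> range r \<subseteq> {1, 2} \<and> r 0 = 1"

definition ab_ba :: "(nat \<Rightarrow> nat) \<Rightarrow> bool" where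
  "ab_ba s \<longleftrightarrow> even (fund_period s) \<and>
    (\<forall>k. (s (2 * k), s (2 * k + 1)) \<in> {(1, 2), (2, 1)})"

definition ba_frequency :: "(nat \<Rightarrow> nat) \<Rightarrow> real" where
  "ba_frequency s =
    2 * real (card {i. i < fund_period s div 2 \<and> (s (2 * i), s (2 * i + 1)) = (2, 1)})
      / real (fund_period s)"

text \<open>A rotor network is given by the heads \<open>e v j\<close> of the out-edges of the non-target
  vertices \<open>v\<close> (\<open>j\<close> counted from \<open>0\<close> as above), the set \<open>T\<close> of targets and the
  source \<open>s\<close>. A state consists of the position of the particle and the number of
  departures made so far from each vertex.\<close>

fun rotor_step :: "('v \<Rightarrow> nat \<Rightarrow> 'v) \<Rightarrow> 'v set \<Rightarrow> 'v \<Rightarrow> 'v \<times> ('v \<Rightarrow> nat) \<Rightarrow> 'v \<times> ('v \<Rightarrow> nat)"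
  where
  "rotor_step e T s (v, c) = (if v \<in> T then (s, c) else (e v (c v), c(v := c v + 1)))"

definition rotor_position :: "('v \<Rightarrow> nat \<Rightarrow> 'v) \<Rightarrow> 'v set \<Rightarrow> 'v \<Rightarrow> nat \<Rightarrow> 'v" where
  "rotor_position e T s t = fst ((rotor_step e T s ^^ t) (s, \<lambda>_. 0))"

text \<open>\<open>enumerate A n\<close> is the \<open>n\<close>-th smallest element of the infinite set \<open>A\<close>; the
  definition is meaningful when targets are reached infinitely often.\<close>

definition hitting_sequence :: "('v \<Rightarrow> nat \<Rightarrow> 'v) \<Rightarrow> 'v set \<Rightarrow> 'v \<Rightarrow> nat \<Rightarrow> 'v" where
  "hitting_sequence e T s n =
    rotor_position e T s (enumerate {t. rotor_position e T s t \<in> T} n)"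

datatype variant = U | D

fun exit_edge :: "variant \<Rightarrow> nat \<Rightarrow> nat \<Rightarrow> nat" where
  "exit_edge U tgt a = (if a = 1 then 1 else tgt)"
| "exit_edge D tgt a = (if a = 1 then tgt else 1)"

text \<open>The value at the targets \<open>4\<close>, \<open>5\<close> is irrelevant.\<close>

definition compressor_edge ::
    "variant \<Rightarrow> variant \<Rightarrow> (nat \<Rightarrow> nat) \<Rightarrow> nat \<Rightarrow> nat \<Rightarrow> nat" where
  "compressor_edge x y r v j =
    (if v = 1 then (if r j = 1 then 2 else 3)
     else if v = 2 then exit_edge x 4 (r j)
     else if v = 3 then exit_edge y 5 (r j)
     else v)"

definition compressor :: "variant \<Rightarrow> variant \<Rightarrow> (nat \<Rightarrow> nat) \<Rightarrow> nat \<Rightarrow> nat" where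
  "compressor x y r = id(4 := 1, 5 := 2) \<circ> hitting_sequence (compressor_edge x y r) {4, 5} 1"

abbreviation UU :: "(nat \<Rightarrow> nat) \<Rightarrow> nat \<Rightarrow> nat" where
  "UU \<equiv> compressor U U"

abbreviation DD :: "(nat \<Rightarrow> nat) \<Rightarrow> nat \<Rightarrow> nat" where
  "DD \<equiv> compressor D D"

end

theory Submission
  imports Defs
begin

text \<open>Two consecutive departures from the source visit each of the vertices 2 and 3 once, and
  both then use the same rotor value \<open>r n\<close>. Hence the \<open>n\<close>-th pair of \<open>r\<close> is either
  copied to the output or swallowed, according to \<open>r n\<close>: the sequence \<open>UU r\<close> is the
  concatenation of the pairs with \<open>r n = 2\<close>, and \<open>DD r\<close> that of the pairs with
  \<open>r n = 1\<close>. Over one period of \<open>r\<close> both values of \<open>r n\<close> are taken equally often,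
  and together the two outputs contain every pair exactly once.\<close>

section \<open>Counting in periodic sequences\<close>

text \<open>The part from \<open>p\<close> onwards is the translate by \<open>p\<close> of the part
  below \<open>m\<close>. No relation between \<open>m\<close> and \<open>p\<close> is assumed, so
  \<open>m\<close> may later be a member of an enumerated set.\<close>

lemma card_periodic_add:
  fixes p :: nat
  assumes "\<And>n. Q (n + p) \<longleftrightarrow> Q n"
  shows "card {n. n < m + p \<and> Q n} = card {n. n < m \<and> Q n} + card {n. n < p \<and> Q n}"
proof -
  have "{n. n < m + p \<and> Q n} = (\<lambda>n. n + p) ` {n. n < m \<and> Q n} \<union> {n. n < p \<and> Q n}"
  proof (intro equalityI subsetI)
    fix n assume n: "n \<in> {n. n < m + p \<and> Q n}"
    show "n \<in> (\<lambda>n. n + p) ` {n. n < m \<and> Q n} \<union> {n. n < p \<and> Q n}"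
    proof (cases "n < p")
      case False
      then obtain k where k: "n = k + p" by (metis add.commute le_add_diff_inverse not_le)
      with n assms[of k] have "k \<in> {n. n < m \<and> Q n}" by simp
      with k show ?thesis by blast
    qed (use n in auto)
  qed (use assms in auto)
  moreover have "card ((\<lambda>n. n + p) ` {n. n < m \<and> Q n}) = card {n. n < m \<and> Q n}"
    by (intro card_image inj_onI) simp
  moreover have "(\<lambda>n. n + p) ` {n. n < m \<and> Q n} \<inter> {n. n < p \<and> Q n} = {}" by auto
  ultimately show ?thesis by (simp add: card_Un_disjoint)
qed

lemma card_periodic_mult:
  fixes p :: nat
  assumes "\<And>n. Q (n + p) \<longleftrightarrow> Q n"
  shows "card {n. n < k * p \<and> Q n} = k * card {n. n < p \<and> Q n}"
proof (induction k)
  case (Suc k)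
  then show ?case using card_periodic_add[of Q p "k * p"] assms by (simp add: add.commute)
qed simp

lemma is_period_mult:
  assumes "is_period s p"
  shows "s (n + k * p) = s n"
proof (induction k)
  case (Suc k)
  have "s (n + Suc k * p) = s ((n + k * p) + p)" by (simp add: ac_simps)
  also have "\<dots> = s (n + k * p)" using assms unfolding is_period_def by blast
  finally show ?case using Suc by simp
qed simp

lemma is_period_fund_period: "is_period s p \<Longrightarrow> is_period s (fund_period s)"
  unfolding fund_period_def by (rule LeastI)

text \<open>Otherwise the nonzero remainder \<open>p mod fund_period s\<close> would be a smaller
  period.\<close>

lemma fund_period_dvd:
  assumes "is_period s p"
  shows "fund_period s dvd p"
proof (rule ccontr)
  let ?d = "fund_period s"
  have d: "is_period s ?d" by (rule is_period_fund_period[OF assms])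
  then have pos: "0 < ?d" by (simp add: is_period_def)
  assume "\<not> ?d dvd p"
  then have "0 < p mod ?d" by (simp add: mod_greater_zero_iff_not_dvd)
  moreover have "s (n + p mod ?d) = s n" for n
  proof -
    have "s (n + p mod ?d) = s ((n + p mod ?d) + (p div ?d) * ?d)"
      by (rule is_period_mult[OF d, symmetric])
    also have "(n + p mod ?d) + (p div ?d) * ?d = n + p" by simp
    finally show ?thesis using assms by (simp add: is_period_def)
  qed
  ultimately have "is_period s (p mod ?d)" by (simp add: is_period_def)
  then have "?d \<le> p mod ?d" unfolding fund_period_def by (rule Least_le)
  with mod_less_divisor[OF pos, of p] show False by simp
qed

section \<open>Sequences of pairs\<close>

lemma card_value_pairs:
  fixes s :: "nat \<Rightarrow> nat"
  assumes "\<And>k. (s (2 * k), s (2 * k + 1)) \<in> {(1, 2), (2, 1)}" and "a \<in> {1, 2}"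
  shows "card {n. n < 2 * k \<and> s n = a} = k"
proof (induction k)
  case (Suc k)
  \<comment> \<open>The unique position of the value \<open>a\<close> inside pair number
    \<open>k\<close>.\<close>
  define j where "j = (if s (2 * k) = a then 2 * k else 2 * k + 1)"
  have "{n. n < 2 * Suc k \<and> s n = a} = insert j {n. n < 2 * k \<and> s n = a}"
    using assms(1)[of k] assms(2) by (auto simp: j_def less_Suc_eq)
  then show ?case using Suc by (simp add: j_def)
qed simp

text \<open>Two periods consist of \<open>d\<close> whole pairs and so contain exactly
  \<open>d\<close> ones; by periodicity this number is twice the count in one period.\<close>

lemma even_period_pairs:
  fixes s :: "nat \<Rightarrow> nat"
  assumes "\<And>k. (s (2 * k), s (2 * k + 1)) \<in> {(1, 2), (2, 1)}" and "is_period s d"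
  shows "even d"
proof -
  have "2 * card {n. n < d \<and> s n = 1} = card {n. n < 2 * d \<and> s n = 1}"
    using assms(2) by (intro card_periodic_mult[symmetric]) (simp add: is_period_def)
  also have "\<dots> = d" by (rule card_value_pairs[OF assms(1)]) simp
  finally show ?thesis by presburger
qed

text \<open>Passing from the fundamental period \<open>2 * e\<close> to a multiple
  \<open>2 * h\<close> scales the count and the length by the same factor. The frequency of an
  output sequence can thus be computed without knowing its fundamental period.\<close>

lemma ba_frequency_eq:
  fixes s :: "nat \<Rightarrow> nat"
  assumes pairs: "\<And>k. (s (2 * k), s (2 * k + 1)) \<in> {(1, 2), (2, 1)}"
    and per: "is_period s (2 * h)"
  shows "ba_frequency s = real (card {i. i < h \<and> s (2 * i) = 2}) / real h"
proof -
  have d: "is_period s (fund_period s)" by (rule is_period_fund_period[OF per])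
  obtain e where e: "fund_period s = 2 * e" using even_period_pairs[OF pairs d] by blast
  have "e dvd h" using fund_period_dvd[OF per] e by simp
  then obtain k where k: "h = k * e" by (metis dvdE mult.commute)
  have "0 < h" using per by (simp add: is_period_def)
  then have pos: "0 < k" "0 < e" using k by auto
  have "s (2 * (n + e)) = s (2 * n)" for n
    using d e by (simp add: is_period_def distrib_left)
  then have "card {i. i < h \<and> s (2 * i) = 2} = k * card {i. i < e \<and> s (2 * i) = 2}"
    unfolding k by (intro card_periodic_mult) simp
  moreover have "(s (2 * i), s (2 * i + 1)) = (2, 1) \<longleftrightarrow> s (2 * i) = 2" for i
    using pairs[of i] by auto
  ultimately show ?thesis
    unfolding ba_frequency_def e using k pos by simp
qed

section \<open>Enumeration of infinite sets\<close>

lemma card_less_enumerate: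
  fixes A :: "nat set"
  assumes "infinite A"
  shows "card {n. n < enumerate A j \<and> n \<in> A} = j"
proof -
  have mono: "strict_mono (enumerate A)" by (rule strict_mono_enumerate[OF assms])
  have "{n. n < enumerate A j \<and> n \<in> range (enumerate A)} = enumerate A ` {..<j}"
    by (auto simp: strict_mono_less[OF mono])
  then have "{n. n < enumerate A j \<and> n \<in> A} = enumerate A ` {..<j}"
    by (simp only: range_enumerate[OF assms])
  moreover have "inj_on (enumerate A) {..<j}"
    by (rule inj_on_subset[OF strict_mono_imp_inj_on[OF mono] subset_UNIV])
  ultimately show ?thesis by (simp add: card_image)
qed

text \<open>A member of an infinite set is determined by its rank, so identifying an enumerated
  element reduces to counting the members below it.\<close>

lemma enumerate_eqI:
  fixes A :: "nat set"
  assumes "infinite A" and "m \<in> A" and "card {n. n < m \<and> n \<in> A} = j"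
  shows "enumerate A j = m"
proof -
  obtain i where i: "enumerate A i = m" using enumerate_Ex[OF assms(1,2)] by blast
  with card_less_enumerate[OF assms(1), of i] assms(3) have "i = j" by simp
  with i show ?thesis by simp
qed

lemma enumerate_range_strict_mono:
  fixes g :: "nat \<Rightarrow> nat"
  assumes "strict_mono g"
  shows "enumerate (range g) j = g j"
proof (rule enumerate_eqI)
  have inj: "inj g" using assms by (rule strict_mono_imp_inj_on)
  then show "infinite (range g)" by (simp add: finite_image_iff)
  have "{n. n < g j \<and> n \<in> range g} = g ` {..<j}"
    using assms by (auto simp: strict_mono_less)
  then show "card {n. n < g j \<and> n \<in> range g} = j"
    using inj by (simp add: card_image inj_on_subset)
qed simp

section \<open>The compressor with equal variants\<close>

text \<open>The rotor value on which vertices 2 and 3 send the particle to their target.\<close>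

fun target_value :: "variant \<Rightarrow> nat" where
  "target_value U = 2"
| "target_value D = 1"

text \<open>A block comprises two excursions from the source. An excursion takes 2 steps if it comes
  straight back and 3 if it passes through a target, whence the lengths 4 and 6.\<close>

fun block_start :: "variant \<Rightarrow> (nat \<Rightarrow> nat) \<Rightarrow> nat \<Rightarrow> nat" where
  "block_start x r 0 = 0"
| "block_start x r (Suc n) = block_start x r n + (if r n = target_value x then 6 else 4)"

lemma strict_mono_block_start: "strict_mono (block_start x r)"
  by (simp add: strict_mono_Suc_iff)

lemma block_start_covers:
  obtains n where "block_start x r n \<le> t" "t < block_start x r (Suc n)"
proof -
  define n where "n = (LEAST n. t < block_start x r (Suc n))"
  have "t < block_start x r (Suc t)"
    using seq_suble[OF strict_mono_block_start, of "Suc t" x r] by linarith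
  then have "t < block_start x r (Suc n)" unfolding n_def by (rule LeastI)
  moreover have "block_start x r n \<le> t"
  proof (cases n)
    case (Suc m)
    then have "\<not> t < block_start x r (Suc m)"
      unfolding n_def by (metis Suc lessI n_def not_less_Least)
    then show ?thesis using Suc by simp
  qed simp
  ultimately show thesis using that by blast
qed

section \<open>Trajectory of the particle, block by block\<close>

context
  fixes r :: "nat \<Rightarrow> nat" and x :: variant
  assumes vals: "\<And>n. r n \<in> {1, 2}"
    and pairs: "\<And>k. (r (2 * k), r (2 * k + 1)) \<in> {(1, 2), (2, 1)}"
begin

text \<open>Keeps the departure counters, which \<open>rotor_position\<close> discards but the
  induction over blocks needs.\<close>

definition state :: "nat \<Rightarrow> nat \<times> (nat \<Rightarrow> nat)" where
  "state t = (rotor_step (compressor_edge x x r) {4, 5} 1 ^^ t) (1, \<lambda>_. 0)"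

lemma state_add:
  "state (t + 1) = rotor_step (compressor_edge x x r) {4, 5} 1 (state t)"
  "state (t + 2) = rotor_step (compressor_edge x x r) {4, 5} 1 (state (t + 1))"
  "state (t + 3) = rotor_step (compressor_edge x x r) {4, 5} 1 (state (t + 2))"
  "state (t + 4) = rotor_step (compressor_edge x x r) {4, 5} 1 (state (t + 3))"
  "state (t + 5) = rotor_step (compressor_edge x x r) {4, 5} 1 (state (t + 4))"
  "state (t + 6) = rotor_step (compressor_edge x x r) {4, 5} 1 (state (t + 5))"
  by (simp_all add: state_def numeral_eq_Suc)

lemma rotor_position_eq: "rotor_position (compressor_edge x x r) {4, 5} 1 t = fst (state t)"
  by (simp add: state_def rotor_position_def)

lemma exit_edge_eq: "exit_edge x tgt (r n) = (if r n = target_value x then tgt else 1)"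
  using vals[of n] by (cases x) auto

lemma exit_edge_target: "exit_edge x tgt (target_value x) = tgt"
  by (cases x) auto

lemma block_swallowed:
  assumes "state t = (1, c)" "c 1 = 2 * n" "c 2 = n" "c 3 = n" and "r n \<noteq> target_value x"
  shows "\<exists>c'. state (t + 4) = (1, c') \<and> c' 1 = 2 * Suc n \<and> c' 2 = Suc n \<and> c' 3 = Suc n"
    and "i < 4 \<Longrightarrow> fst (state (t + i)) \<notin> {4, 5}"
proof -
  \<comment> \<open>The vertices visited by the two excursions. They are distinct because the pair
    is (1,2) or (2,1), so the second excursion still finds its counter at \<open>n\<close> and reads
    \<open>r n\<close> again.\<close>
  define v w :: nat where "v = 1 + r (2 * n)" and "w = 1 + r (2 * n + 1)"
  have vw: "v = 2 \<and> w = 3 \<or> v = 3 \<and> w = 2"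
    and v: "(if r (2 * n) = 1 then 2 else 3) = v"
    and w: "(if r (Suc (2 * n)) = 1 then 2 else 3) = w"
    using pairs[of n] by (auto simp: v_def w_def)
  have s1: "state (t + 1) = (v, c(1 := 2 * n + 1))"
    unfolding state_add(1) using assms v by (simp add: compressor_edge_def)
  have s2: "state (t + 2) = (1, c(1 := 2 * n + 1, v := n + 1))"
    unfolding state_add(2) s1 using vw
    by (elim disjE conjE; simp add: compressor_edge_def exit_edge_eq assms[simplified])
  have s3: "state (t + 3) = (w, c(1 := 2 * n + 2, v := n + 1))"
    unfolding state_add(3) s2 using vw w
    by (elim disjE conjE; simp add: compressor_edge_def fun_upd_twist assms[simplified])
  have s4: "state (t + 4) = (1, c(1 := 2 * n + 2, v := n + 1, w := n + 1))"
    unfolding state_add(4) s3 using vw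
    by (elim disjE conjE; simp add: compressor_edge_def exit_edge_eq assms[simplified])
  show "\<exists>c'. state (t + 4) = (1, c') \<and> c' 1 = 2 * Suc n \<and> c' 2 = Suc n \<and> c' 3 = Suc n"
    using vw by (auto simp: s4)
  show "i < 4 \<Longrightarrow> fst (state (t + i)) \<notin> {4, 5}"
  proof -
    assume "i < 4"
    then have "i \<in> {0, 1, 2, 3}" by auto
    then show ?thesis using vw assms(1) s1 s2 s3 by auto
  qed
qed

text \<open>Now each excursion goes on from vertex \<open>1 + a\<close> to target
  \<open>3 + a\<close>, where \<open>a\<close> is the source's rotor value; offsets 2 and 5 are the
  only hits.\<close>

lemma block_copied:
  assumes "state t = (1, c)" "c 1 = 2 * n" "c 2 = n" "c 3 = n" and "r n = target_value x"
  shows "\<exists>c'. state (t + 6) = (1, c') \<and> c' 1 = 2 * Suc n \<and> c' 2 = Suc n \<and> c' 3 = Suc n"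
    and "fst (state (t + 2)) = 3 + r (2 * n)"
    and "fst (state (t + 5)) = 3 + r (2 * n + 1)"
    and "i < 6 \<Longrightarrow> fst (state (t + i)) \<in> {4, 5} \<longleftrightarrow> i \<in> {2, 5}"
proof -
  define v w :: nat where "v = 1 + r (2 * n)" and "w = 1 + r (2 * n + 1)"
  have vw: "v = 2 \<and> w = 3 \<or> v = 3 \<and> w = 2"
    and v: "(if r (2 * n) = 1 then 2 else 3) = v"
    and w: "(if r (Suc (2 * n)) = 1 then 2 else 3) = w"
    using pairs[of n] by (auto simp: v_def w_def)
  have s1: "state (t + 1) = (v, c(1 := 2 * n + 1))"
    unfolding state_add(1) using assms v by (simp add: compressor_edge_def)
  have s2: "state (t + 2) = (v + 2, c(1 := 2 * n + 1, v := n + 1))"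
    unfolding state_add(2) s1 using vw
    by (elim disjE conjE; simp add: compressor_edge_def exit_edge_target assms[simplified])
  have s3: "state (t + 3) = (1, c(1 := 2 * n + 1, v := n + 1))"
    unfolding state_add(3) s2 using vw by auto
  have s4: "state (t + 4) = (w, c(1 := 2 * n + 2, v := n + 1))"
    unfolding state_add(4) s3 using vw w
    by (elim disjE conjE; simp add: compressor_edge_def fun_upd_twist assms[simplified])
  have s5: "state (t + 5) = (w + 2, c(1 := 2 * n + 2, v := n + 1, w := n + 1))"
    unfolding state_add(5) s4 using vw
    by (elim disjE conjE; simp add: compressor_edge_def exit_edge_target assms[simplified])
  have s6: "state (t + 6) = (1, c(1 := 2 * n + 2, v := n + 1, w := n + 1))"
    unfolding state_add(6) s5 using vw by auto
  show "\<exists>c'. state (t + 6) = (1, c') \<and> c' 1 = 2 * Suc n \<and> c' 2 = Suc n \<and> c' 3 = Suc n"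
    using vw by (auto simp: s6)
  show "fst (state (t + 2)) = 3 + r (2 * n)" "fst (state (t + 5)) = 3 + r (2 * n + 1)"
    unfolding s2 s5 by (simp_all add: v_def w_def)
  show "i < 6 \<Longrightarrow> fst (state (t + i)) \<in> {4, 5} \<longleftrightarrow> i \<in> {2, 5}"
  proof -
    assume "i < 6"
    then have "i \<in> {0, 1, 2, 3, 4, 5}" by auto
    then show ?thesis using vw assms(1) s1 s2 s3 s4 s5 by auto
  qed
qed

text \<open>Both kinds of block advance the three counters in the same way, so the invariant does
  not depend on which pairs were swallowed.\<close>

lemma state_block_start:
  "\<exists>c. state (block_start x r n) = (1, c) \<and> c 1 = 2 * n \<and> c 2 = n \<and> c 3 = n"
proof (induction n)
  case 0
  show ?case by (simp add: state_def)
next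
  case (Suc n)
  then obtain c where c: "state (block_start x r n) = (1, c)" "c 1 = 2 * n" "c 2 = n" "c 3 = n"
    by blast
  show ?case using block_swallowed(1)[OF c] block_copied(1)[OF c] by simp
qed

lemma compressor_pairs:
  assumes inf: "infinite {n. r n = target_value x}"
  defines "e \<equiv> enumerate {n. r n = target_value x}"
  shows "compressor x x r (2 * j) = r (2 * e j)"
    and "compressor x x r (2 * j + 1) = r (2 * e j + 1)"
proof -
  \<comment> \<open>The time of the \<open>j\<close>-th hit: copied block number
    \<open>j div 2\<close>, first or second target within it.\<close>
  define g where "g j = block_start x r (e (j div 2)) + (if even j then 2 else 5)" for j
  have e: "r (e j) = target_value x" for j
    using enumerate_in_set[OF inf] by (simp add: e_def)
  have g_mono: "strict_mono g"
    unfolding strict_mono_Suc_iff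
  proof
    fix j
    show "g j < g (Suc j)"
    proof (cases "even j")
      case False
      have "e (j div 2) < e (Suc (j div 2))"
        unfolding e_def using inf by (rule enumerate_step)
      \<comment> \<open>After the second hit of a copied block, the next hit lies in the next copied
        block, which starts no earlier than this one ends.\<close>
      then have "block_start x r (Suc (e (j div 2))) \<le> block_start x r (e (Suc (j div 2)))"
        using strict_mono_block_start[of x r] by (simp only: strict_mono_less_eq Suc_le_eq)
      then show ?thesis using False e by (simp add: g_def)
    qed (simp add: g_def)
  qed
  have "{t. fst (state t) \<in> {4, 5}} = range g"
  proof (intro equalityI subsetI)
    fix t assume "t \<in> {t. fst (state t) \<in> {4, 5}}"
    then have t: "fst (state t) \<in> {4, 5}" by simp
    obtain n where n: "block_start x r n \<le> t" "t < block_start x r (Suc n)"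
      by (rule block_start_covers)
    obtain c where c: "state (block_start x r n) = (1, c)" "c 1 = 2 * n" "c 2 = n" "c 3 = n"
      using state_block_start by blast
    define i where "i = t - block_start x r n"
    have ti: "t = block_start x r n + i" using n(1) by (simp add: i_def)
    have hit: "r n = target_value x"
    proof (rule ccontr)
      assume "r n \<noteq> target_value x"
      with block_swallowed(2)[OF c this, of i] n(2) t ti show False by simp
    qed
    with block_copied(4)[OF c hit, of i] n(2) t ti have i: "i = 2 \<or> i = 5" by auto
    obtain k where k: "e k = n" using enumerate_Ex[OF inf, of n] hit by (auto simp: e_def)
    have "t = g (2 * k) \<or> t = g (2 * k + 1)" using i k ti by (auto simp: g_def)
    then show "t \<in> range g" by blast
  next
    fix t assume "t \<in> range g"
    then obtain j where j: "t = g j" by blast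
    obtain c where c: "state (block_start x r (e (j div 2))) = (1, c)" "c 1 = 2 * e (j div 2)"
      "c 2 = e (j div 2)" "c 3 = e (j div 2)"
      using state_block_start by blast
    show "t \<in> {t. fst (state t) \<in> {4, 5}}"
      using block_copied(4)[OF c e, of 2] block_copied(4)[OF c e, of 5] by (simp add: j g_def)
  qed
  then have hs: "hitting_sequence (compressor_edge x x r) {4, 5} 1 j = fst (state (g j))" for j
    by (simp only: hitting_sequence_def rotor_position_eq enumerate_range_strict_mono[OF g_mono])
  obtain c where c: "state (block_start x r (e j)) = (1, c)" "c 1 = 2 * e j" "c 2 = e j" "c 3 = e j"
    using state_block_start by blast
  show "compressor x x r (2 * j) = r (2 * e j)"
    unfolding compressor_def o_apply hs
    using block_copied(2)[OF c e] vals[of "2 * e j"] by (auto simp: g_def)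
  show "compressor x x r (2 * j + 1) = r (2 * e j + 1)"
    unfolding compressor_def o_apply hs
    using block_copied(3)[OF c e] vals[of "2 * e j + 1"] by (auto simp: g_def)
qed

text \<open>Among \<open>2 * h\<close> consecutive indices exactly \<open>h\<close> carry the
  selecting value, so \<open>h\<close> output pairs come from \<open>2 * h\<close> input pairs, that
  is, from the stretch of length \<open>4 * h\<close> in \<open>r\<close>.\<close>

lemma ba_frequency_compressor:
  assumes per: "is_period r (2 * h)"
  shows "ba_frequency (compressor x x r) =
    real (card {n. n < 2 * h \<and> r n = target_value x \<and> r (2 * n) = 2}) / real h"
proof -
  define K where "K = {n. r n = target_value x}"
  define e where "e = enumerate K"
  have a: "target_value x \<in> {1, 2}" by (cases x) auto
  have h: "0 < h" and perK: "n + 2 * h \<in> K \<longleftrightarrow> n \<in> K" for n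
    using per by (auto simp: is_period_def K_def)
  have cardK: "card {n. n < 2 * k \<and> n \<in> K} = k" for k
    unfolding K_def using card_value_pairs[OF pairs a] by simp
  have inf: "infinite K"
  proof
    assume fin: "finite K"
    have "card {n. n < 2 * Suc (card K) \<and> n \<in> K} \<le> card K"
      using fin by (intro card_mono) auto
    then show False unfolding cardK by simp
  qed
  \<comment> \<open>Below \<open>e j + 2 * h\<close> lie \<open>h\<close> selected indices from one
    period and \<open>j\<close> more from the shifted part.\<close>
  have e_shift: "e (j + h) = e j + 2 * h" for j
    unfolding e_def
  proof (rule enumerate_eqI[OF inf])
    show "enumerate K j + 2 * h \<in> K" using enumerate_in_set[OF inf] perK by blast
    show "card {n. n < enumerate K j + 2 * h \<and> n \<in> K} = j + h"
      using card_periodic_add[of "\<lambda>n. n \<in> K" "2 * h", OF perK]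
      by (simp add: cardK card_less_enumerate[OF inf])
  qed
  have inj: "inj_on e {..<h}"
    unfolding e_def using strict_mono_imp_inj_on[OF strict_mono_enumerate[OF inf]]
    by (rule inj_on_subset) (rule subset_UNIV)
  \<comment> \<open>Both sides have \<open>h\<close> elements, so one inclusion suffices.\<close>
  have img: "e ` {..<h} = {n. n < 2 * h \<and> n \<in> K}"
  proof (rule card_subset_eq)
    show "e ` {..<h} \<subseteq> {n. n < 2 * h \<and> n \<in> K}"
    proof clarify
      fix i assume "i < h"
      have "e i < 2 * h"
      proof (rule ccontr)
        assume "\<not> e i < 2 * h"
        then have "card {n. n < 2 * h \<and> n \<in> K} \<le> card {n. n < e i \<and> n \<in> K}"
          by (intro card_mono) auto
        then show False
          using \<open>i < h\<close> cardK card_less_enumerate[OF inf, of i] by (simp add: e_def)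
      qed
      then show "e i < 2 * h \<and> e i \<in> K" using enumerate_in_set[OF inf] by (simp add: e_def)
    qed
    show "card (e ` {..<h}) = card {n. n < 2 * h \<and> n \<in> K}"
      using inj cardK by (simp add: card_image)
  qed simp
  have s: "compressor x x r (2 * j) = r (2 * e j)"
    "compressor x x r (2 * j + 1) = r (2 * e j + 1)" for j
    using compressor_pairs inf by (simp_all add: e_def K_def)
  have s_per: "is_period (compressor x x r) (2 * h)"
    unfolding is_period_def
  proof (intro conjI allI)
    fix n :: nat
    have sh: "2 * k + 2 * h = 2 * (k + h)" "2 * k + 1 + 2 * h = 2 * (k + h) + 1" for k by simp_all
    \<comment> \<open>Doubling the index turns the shift by \<open>2 * h\<close> into two periods of
      \<open>r\<close>.\<close>
    have re: "r (2 * e (j + h)) = r (2 * e j)" "r (2 * e (j + h) + 1) = r (2 * e j + 1)" for j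
      using is_period_mult[OF per, of "2 * e j" 2] is_period_mult[OF per, of "2 * e j + 1" 2]
      by (simp_all add: e_shift distrib_left)
    consider k where "n = 2 * k" | k where "n = 2 * k + 1" by (meson evenE oddE)
    then show "compressor x x r (n + 2 * h) = compressor x x r n"
      by cases (simp_all only: sh s re)
  qed (use h in simp)
  have s_pairs: "(compressor x x r (2 * k), compressor x x r (2 * k + 1)) \<in> {(1, 2), (2, 1)}" for k
    unfolding s by (rule pairs)
  have "e ` {i. i < h \<and> r (2 * e i) = 2} = {n. n < 2 * h \<and> r n = target_value x \<and> r (2 * n) = 2}"
  proof -
    have "e ` {i. i < h \<and> r (2 * e i) = 2} = {n \<in> e ` {..<h}. r (2 * n) = 2}" by auto
    also have "\<dots> = {n. n < 2 * h \<and> r n = target_value x \<and> r (2 * n) = 2}"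
      unfolding img by (auto simp: K_def)
    finally show ?thesis .
  qed
  moreover have "inj_on e {i. i < h \<and> r (2 * e i) = 2}" using inj by (rule inj_on_subset) auto
  then have "card (e ` {i. i < h \<and> r (2 * e i) = 2}) = card {i. i < h \<and> r (2 * e i) = 2}"
    by (rule card_image)
  ultimately have "card {n. n < 2 * h \<and> r n = target_value x \<and> r (2 * n) = 2}
      = card {i. i < h \<and> r (2 * e i) = 2}"
    by (rule subst)
  then show ?thesis using ba_frequency_eq[OF s_pairs s_per] by (simp only: s)
qed

end

section \<open>Combining the two variants\<close>

theorem theorem8p2:
  fixes r :: "nat \<Rightarrow> nat"
  assumes "rotor_type r" and "ab_ba r"
  shows "ba_frequency (UU r) + ba_frequency (DD r) = 2 * ba_frequency r"
proof -
  have vals: "r n \<in> {1, 2}" for n using assms(1) by (auto simp: rotor_type_def)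
  have pairs: "(r (2 * k), r (2 * k + 1)) \<in> {(1, 2), (2, 1)}" for k
    using assms(2) unfolding ab_ba_def by blast
  obtain p where "is_period r p" using assms(1) by (auto simp: rotor_type_def)
  then have "is_period r (fund_period r)" by (rule is_period_fund_period)
  moreover obtain h where "fund_period r = 2 * h" using assms(2) by (auto simp: ab_ba_def)
  ultimately have per: "is_period r (2 * h)" by simp
  let ?N = "\<lambda>a. {n. n < 2 * h \<and> r n = a \<and> r (2 * n) = 2}"
  have "?N 2 \<union> ?N 1 = {n. n < 2 * h \<and> r (2 * n) = 2}" using vals by auto
  moreover have "card (?N 2 \<union> ?N 1) = card (?N 2) + card (?N 1)"
    by (rule card_Un_disjoint) auto
  \<comment> \<open>The sequence of pairs has period \<open>h\<close>, so the range
    \<open>2 * h\<close> meets every pair of one period twice; this is the factor 2 of the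
    theorem.\<close>
  moreover have "card {n. n < 2 * h \<and> r (2 * n) = 2} = 2 * card {n. n < h \<and> r (2 * n) = 2}"
    using per by (intro card_periodic_mult) (simp add: is_period_def distrib_left)
  ultimately have "card (?N 2) + card (?N 1) = 2 * card {n. n < h \<and> r (2 * n) = 2}"
    by metis
  from arg_cong[OF this, of real]
  have "real (card (?N 2)) + real (card (?N 1)) = 2 * real (card {n. n < h \<and> r (2 * n) = 2})"
    by simp
  then show ?thesis
    using ba_frequency_compressor[OF vals pairs per, of U]
      ba_frequency_compressor[OF vals pairs per, of D] ba_frequency_eq[OF pairs per]
    by (simp add: add_divide_distrib[symmetric])
qed

end
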